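(* Let $(F_h)_{h>0}$ be a family of piecewise smooth functions $F_h:\mathbb{T}\to\mathbb{R}$ whose graphs define bilaterally symmetric billiard cells, indexed by the flatness parameter $h$ (that is, $h=\int_{\mathbb{T}}\frac{F_h'(r)^2}{1+F_h'(r)^2}\,dr$). Let $(P_h)_{h>0}$ be the corresponding Markov transition operators and $L_h=P_h-I$. Then for any $f\in C^3(\mathcal{X})$, $\mathcal{X}=(-1,1)$, $$L_hf(x)=2h\,\mathcal{L}f(x)+O\left(h^{3/2}\right)\qquad (h\to0)$$ holds for each velocity $x\in\mathcal{X}$ such that every initial condition with velocity $x$ results in a trajectory that collides only once with the boundary of the cell. Here $$\mathcal{L}f(x)=\frac{d}{dx}\left((1-x^2)\frac{d}{dx}f(x)\right).$$
   Context: Random billiard setting. $\mathbb{T}$ is the one-dimensional torus (the interval $(0,\ell)$ with periodic endpoints) and $dr$ is normalized Lebesgue measure on $\mathbb{T}$. For a piecewise smooth $F:\mathbb{T}\to\mathbb{R}$, the billiard cell is $M=\{(r,y)\in\mathbb{T}\times\mathbb{R}: y\ge F(r)\}$. Fix $c>\sup F$; the line $y=c$ is the reference line. A point particle starts at $(r,c)$ with unit velocity pointing downward into the cell, moves along straight lines, reflects specularly (elastic billiard reflection) at non-corner points of the graph of $F$, and obeys periodic conditions across the vertical sides of the cell. For almost every initial condition it returns to the reference line. Velocities (incoming, or outgoing upon return) are parametrized by the cosine $x\in\mathcal{X}=(-1,1)$ of the angle with the reference line, i.e. by the horizontal component of the unit velocity vector. $X(r,x)\in\mathcal{X}$ denotes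 the return velocity for initial condition $(r,x)$. The Markov transition operator is $(Pf)(x)=\int_{\mathbb{T}}f(X(r,x))\,dr$. The cell is bilaterally symmetric if $F(r)=F(\ell-r)$ for all $r\in(0,\ell)$. The flatness parameter of $F$ is $h=\int_{\mathbb{T}}\bar n(r)^2\,dr=\int_{\mathbb{T}}\frac{F'(r)^2}{1+F'(r)^2}\,dr$, where $\bar n$ is the horizontal component of the unit normal vector field along the graph of $F$. The single-collision condition at $x$ refers to the billiard cell of $F_h$ for the value of $h$ under consideration: all trajectories starting at $(r,c)$, $r\in\mathbb{T}$, with velocity $x$ hit the graph of $F_h$ exactly once before returning to the reference line. The error $O(h^{3/2})$ is pointwise for fixed $f$ and $x$.
   Formalization: The formal theorem also assumes that the horizontal normal component satisfies |n̄| ≤ K√h uniformly along the graph, with K independent of h; without a bound of this kind the claim fails (narrow tents of fixed slope). The family is indexed by 0<h<h0, since the flatness is always below 1. *)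

theory Defs
  imports "HOL-Analysis.Analysis" "HOL-Library.Landau_Symbols"
begin

text \<open>
  Functions on the torus of length \<open>l\<close> are \<open>l\<close>-periodic functions on the real line, and the billiard
  motion is followed in the universal cover of the cell (the region above the periodically extended
  graph in the plane); crossing a vertical side of the cell is then not an event.
\<close>

definition torus_measure :: "real \<Rightarrow> real measure" where
  "torus_measure l = uniform_measure lborel {0..<l}"

definition smooth_on_open :: "(real \<Rightarrow> real) \<Rightarrow> real set \<Rightarrow> bool" where
  "smooth_on_open F U \<longleftrightarrow> (\<forall>n. \<forall>r\<in>U. (deriv ^^ n) F differentiable (at r))"

definition C_k_on :: "nat \<Rightarrow> (real \<Rightarrow> real) \<Rightarrow> real set \<Rightarrow> bool" where
  "C_k_on k f U \<longleftrightarrow>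
     (\<forall>j<k. \<forall>x\<in>U. (deriv ^^ j) f differentiable (at x)) \<and> continuous_on U ((deriv ^^ k) f)"

text \<open>Continuity makes the graph alone the boundary of the cell (there are no vertical walls).\<close>

definition piecewise_smooth_torus :: "real \<Rightarrow> (real \<Rightarrow> real) \<Rightarrow> bool" where
  "piecewise_smooth_torus l F \<longleftrightarrow>
     (\<forall>r. F (r + l) = F r) \<and> continuous_on UNIV F \<and>
     (\<exists>S. finite S \<and> smooth_on_open F ({0<..<l} - S))"

definition bilaterally_symmetric :: "real \<Rightarrow> (real \<Rightarrow> real) \<Rightarrow> bool" where
  "bilaterally_symmetric l F \<longleftrightarrow> (\<forall>r\<in>{0<..<l}. F r = F (l - r))"

definition flatness :: "real \<Rightarrow> (real \<Rightarrow> real) \<Rightarrow> real" where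
  "flatness l F = (\<integral>r. (deriv F r)\<^sup>2 / (1 + (deriv F r)\<^sup>2) \<partial>torus_measure l)"

text \<open>
  The upward unit normal at the graph point over \<open>r\<close>. It is meaningful where \<open>F\<close> is differentiable;
  graph points over all other \<open>r\<close> are the corners.
\<close>

definition unit_normal :: "(real \<Rightarrow> real) \<Rightarrow> real \<Rightarrow> real \<times> real" where
  "unit_normal F r = (1 / sqrt (1 + (deriv F r)\<^sup>2)) *\<^sub>R (- deriv F r, 1)"

text \<open>
  The flatness controls only the mean square of the horizontal normal component. The expansion of the
  generator with error \<open>O(h powr (3/2))\<close> needs that component to be of order \<open>sqrt h\<close> uniformly along the
  graph, which the theorem therefore assumes. It fails otherwise: for \<open>l = 1\<close> and \<open>F h\<close> zero except for
  a centred tent of width \<open>10 * h\<close> with slopes \<open>1/3\<close> and \<open>- 1/3\<close>, the flatness is \<open>h\<close>, every vertical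
  trajectory collides once, and for \<open>f x = x ^ 4\<close> at \<open>x = 0\<close> the generator gives \<open>1.296 * h\<close> while the
  Legendre operator gives \<open>0\<close>.
\<close>

definition specular_reflection :: "real \<times> real \<Rightarrow> real \<times> real \<Rightarrow> real \<times> real" where
  "specular_reflection n v = v - (2 * (v \<bullet> n)) *\<^sub>R n"

definition flies_above :: "(real \<Rightarrow> real) \<Rightarrow> real \<times> real \<Rightarrow> real \<times> real \<Rightarrow> real \<Rightarrow> bool" where
  "flies_above F p v t \<longleftrightarrow> (\<forall>s\<in>{0<..<t}. F (fst (p + s *\<^sub>R v)) < snd (p + s *\<^sub>R v))"

text \<open>
  \<open>next_hit F p v r\<close>: the straight flight from \<open>p\<close> with velocity \<open>v\<close> next meets the graph over \<open>r\<close>.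
\<close>

definition next_hit :: "(real \<Rightarrow> real) \<Rightarrow> real \<times> real \<Rightarrow> real \<times> real \<Rightarrow> real \<Rightarrow> bool" where
  "next_hit F p v r \<longleftrightarrow> (\<exists>t>0. flies_above F p v t \<and> p + t *\<^sub>R v = (r, F r))"

definition returns_to_line ::
  "(real \<Rightarrow> real) \<Rightarrow> real \<Rightarrow> real \<times> real \<Rightarrow> real \<times> real \<Rightarrow> bool" where
  "returns_to_line F c p v \<longleftrightarrow> (\<exists>t>0. flies_above F p v t \<and> snd (p + t *\<^sub>R v) = c)"

text \<open>
  \<open>billiard_run F c n p v w\<close>: starting at \<open>p\<close> with velocity \<open>v\<close>, the particle reflects exactly \<open>n\<close>
  times, always at non-corner points, and then returns to the line \<open>y = c\<close> with velocity \<open>w\<close>.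
\<close>

inductive billiard_run ::
  "(real \<Rightarrow> real) \<Rightarrow> real \<Rightarrow> nat \<Rightarrow> real \<times> real \<Rightarrow> real \<times> real \<Rightarrow> real \<times> real \<Rightarrow> bool"
  for F :: "real \<Rightarrow> real" and c :: real where
  return: "returns_to_line F c p v \<Longrightarrow> billiard_run F c 0 p v v"
| collide: "\<lbrakk>next_hit F p v r; F differentiable (at r);
      billiard_run F c n (r, F r) (specular_reflection (unit_normal F r) v) w\<rbrakk>
    \<Longrightarrow> billiard_run F c (Suc n) p v w"

definition incoming_velocity :: "real \<Rightarrow> real \<times> real" where
  "incoming_velocity x = (x, - sqrt (1 - x\<^sup>2))"

text \<open>
  The horizontal component of the velocity on return to the reference line (unspecified for the
  exceptional trajectories that run into a corner or never return).
\<close>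

definition return_velocity :: "(real \<Rightarrow> real) \<Rightarrow> real \<Rightarrow> real \<Rightarrow> real \<Rightarrow> real" where
  "return_velocity F c r x = fst (THE w. \<exists>n. billiard_run F c n (r, c) (incoming_velocity x) w)"

text \<open>
  Every trajectory with initial velocity \<open>x\<close> hits the graph exactly once before returning. A trajectory
  whose first hit is a corner has no continuation and hits the graph once; it is the only exception to
  having a run with one reflection.
\<close>

definition single_collision :: "real \<Rightarrow> (real \<Rightarrow> real) \<Rightarrow> real \<Rightarrow> real \<Rightarrow> bool" where
  "single_collision l F c x \<longleftrightarrow>
     (\<forall>r\<in>{0..<l}.
        (\<exists>w. billiard_run F c 1 (r, c) (incoming_velocity x) w) \<or>
        (\<exists>q. next_hit F (r, c) (incoming_velocity x) q \<and> \<not> F differentiable (at q)))"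

definition transition_operator ::
  "real \<Rightarrow> (real \<Rightarrow> real) \<Rightarrow> real \<Rightarrow> (real \<Rightarrow> real) \<Rightarrow> real \<Rightarrow> real" where
  "transition_operator l F c f x = (\<integral>r. f (return_velocity F c r x) \<partial>torus_measure l)"

definition billiard_generator ::
  "real \<Rightarrow> (real \<Rightarrow> real) \<Rightarrow> real \<Rightarrow> (real \<Rightarrow> real) \<Rightarrow> real \<Rightarrow> real" where
  "billiard_generator l F c f x = transition_operator l F c f x - f x"

definition legendre_operator :: "(real \<Rightarrow> real) \<Rightarrow> real \<Rightarrow> real" where
  "legendre_operator f = deriv (\<lambda>x. (1 - x\<^sup>2) * deriv f x)"

end

theory Submission
  imports Defs
begin

text \<open>
  Write \<open>s = sqrt (1 - x\<^sup>2)\<close>. The trajectory that first hits the graph over \<open>q\<close> starts on the reference line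
  at \<open>q - x / s * (c - F q)\<close>; since the slope of \<open>F\<close> is of order \<open>sqrt h\<close>, for small \<open>h\<close> this is an increasing
  homeomorphism commuting with the period, with derivative \<open>1 + x / s * F' q\<close>. Substituting it turns the average
  over starting points into an average over collision points of a function of the horizontal normal component
  \<open>a\<close> alone, whose Taylor expansion at \<open>a = 0\<close> has quadratic coefficient twice the Legendre operator. The linear
  term averages to zero because bilateral symmetry makes \<open>a\<close> odd, and the mean of \<open>a\<^sup>2\<close> is \<open>h\<close>.
\<close>

section \<open>Periodic functions and their integrals over one period\<close>

lemma periodic_shift_int:
  fixes u :: "real \<Rightarrow> 'a"
  assumes "\<And>r. u (r + l) = u r"
  shows "u (r + of_int k * l) = u r"
proof -
  have nat: "u (r + of_nat n * l) = u r" for n r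
  proof (induction n)
    case (Suc n)
    have "u (r + of_nat (Suc n) * l) = u (r + of_nat n * l + l)"
      by (simp add: algebra_simps)
    then show ?case using Suc assms by simp
  qed simp
  show ?thesis
  proof (cases "k \<ge> 0")
    case True
    then show ?thesis using nat[of r "nat k"] by simp
  next
    case False
    then show ?thesis using nat[of "r + of_int k * l" "nat (- k)"] by simp
  qed
qed

lemma floor_representative:
  fixes l :: real
  assumes "0 < l"
  shows "r - of_int \<lfloor>r / l\<rfloor> * l \<in> {0..<l}"
proof -
  have "of_int \<lfloor>r / l\<rfloor> * l \<le> r" using assms by (meson floor_divide_lower)
  moreover have "r < (of_int \<lfloor>r / l\<rfloor> + 1) * l" using assms by (meson floor_divide_upper)
  ultimately show ?thesis by (simp add: algebra_simps)
qed

text \<open>The new window is moved by a multiple \<open>d\<close> of the period so that its left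
  end \<open>p\<close> falls in the old window. Only the piece \<open>{a..p}\<close> then has to be
  carried across by one period, which swaps the two pieces without changing their sum.\<close>

lemma has_integral_periodic:
  fixes u :: "real \<Rightarrow> real"
  assumes l: "0 < l" and per: "\<And>r. u (r + l) = u r" and I: "(u has_integral I) {a..a+l}"
  shows "(u has_integral I) {b..b+l}"
proof -
  define d where "d = of_int \<lfloor>(b - a) / l\<rfloor> * l"
  define p where "p = b - d"
  have p: "a \<le> p" "p < a + l"
    using floor_representative[OF l, of "b - a"] by (auto simp: p_def d_def)
  have int: "u integrable_on {a..p}" "u integrable_on {p..a+l}"
    using I p by (auto intro: integrable_subinterval_real dest!: has_integral_integrable)
  define i j where "i = integral {a..p} u" and "j = integral {p..a+l} u"
  have i: "(u has_integral i) {a..p}" and j: "(u has_integral j) {p..a+l}"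
    using int by (auto simp: i_def j_def)
  have I_eq: "I = i + j"
    using has_integral_combine[OF _ _ i j] I p by (metis has_integral_unique less_imp_le)
  have "(u has_integral i) {a+l..p+l}"
    using has_integral_shift_real_ivl[OF i, of "- l"] per[of "_ - l"] by simp
  from has_integral_combine[OF _ _ j this] have "(u has_integral (j + i)) {p..p+l}"
    using p l by simp
  from has_integral_shift_real_ivl[OF this, of "- d"]
  have "((\<lambda>r. u (r - d)) has_integral I) {b..b+l}"
    by (simp add: I_eq p_def add.commute)
  moreover have "u (r - d) = u r" for r
    using periodic_shift_int[of u l r "- \<lfloor>(b - a) / l\<rfloor>"] per by (simp add: d_def)
  ultimately show ?thesis by simp
qed

section \<open>Bounded Borel functions and the normalized measure on the torus\<close>

lemma set_integrable_bounded_borel: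
  fixes g :: "real \<Rightarrow> real"
  assumes "g \<in> borel_measurable borel" "\<And>r. \<bar>g r\<bar> \<le> C" "A \<in> sets borel" "A \<subseteq> {a..b}"
  shows "set_integrable lborel A g"
  unfolding set_integrable_def
proof (rule integrableI_bounded_set_indicator)
  have "emeasure lborel A \<le> emeasure lborel {a..b}" using assms by (intro emeasure_mono) auto
  also have "\<dots> < \<infinity>" by (cases "a \<le> b") auto
  finally show "emeasure lborel A < \<infinity>" .
qed (use assms in auto)

lemma absolutely_integrable_bounded_borel:
  fixes g :: "real \<Rightarrow> real"
  assumes "g \<in> borel_measurable borel" "\<And>r. \<bar>g r\<bar> \<le> C" "A \<in> sets borel" "A \<subseteq> {a..b}"
  shows "g absolutely_integrable_on A"
  using set_integrable_bounded_borel[OF assms] assms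
  unfolding set_integrable_def by (intro integrable_completion[THEN iffD2]) auto

lemma torus_measure_density:
  assumes "0 < l"
  shows "torus_measure l = density lborel (\<lambda>r. ennreal (indicator {0..<l} r / l))"
  unfolding torus_measure_def uniform_measure_def
  using assms by (intro arg_cong2[where f=density] refl ext) (auto simp: divide_ennreal indicator_def simp flip: ennreal_1)

lemma sets_torus_measure [simp]: "sets (torus_measure l) = sets borel"
  by (simp add: torus_measure_def)

lemma space_torus_measure [simp]: "space (torus_measure l) = UNIV"
  by (simp add: torus_measure_def)

lemma measurable_torus_measure: "borel_measurable (torus_measure l) = borel_measurable borel"
  by (rule measurable_cong_sets) auto

lemma emeasure_torus_UNIV: "0 < l \<Longrightarrow> emeasure (torus_measure l) UNIV = 1"
  by (simp add: torus_measure_def ennreal_divide_self)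

lemma finite_measure_torus: "0 < l \<Longrightarrow> finite_measure (torus_measure l)"
  by (rule finite_measureI) (simp add: emeasure_torus_UNIV)

lemma measure_torus_UNIV: "0 < l \<Longrightarrow> measure (torus_measure l) UNIV = 1"
  by (simp add: measure_def emeasure_torus_UNIV)

lemma integrable_torus:
  fixes g :: "real \<Rightarrow> real"
  assumes "0 < l" "g \<in> borel_measurable borel" "\<And>r. \<bar>g r\<bar> \<le> C"
  shows "integrable (torus_measure l) g"
  using assms
  by (intro finite_measure.integrable_const_bound[OF finite_measure_torus, where B=C])
     (auto simp: measurable_torus_measure)

lemma integral_torus:
  fixes g :: "real \<Rightarrow> real"
  assumes l: "0 < l" and g: "g \<in> borel_measurable borel" "\<And>r. \<bar>g r\<bar> \<le> C"
  shows "(\<integral>r. g r \<partial>torus_measure l) = integral {0..l} g / l"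
proof -
  have "(\<integral>r. g r \<partial>torus_measure l) = (\<integral>r. (indicator {0..<l} r / l) *\<^sub>R g r \<partial>lborel)"
    unfolding torus_measure_density[OF l] using l g by (intro integral_density) auto
  also have "\<dots> = (\<integral>r. indicator {0..<l} r *\<^sub>R g r \<partial>lborel) / l"
    by (subst integral_divide_zero[symmetric]) (simp add: field_simps)
  also have "(\<integral>r. indicator {0..<l} r *\<^sub>R g r \<partial>lborel) = integral {0..<l} g"
    using set_borel_integral_eq_integral(2)[OF set_integrable_bounded_borel[of g C "{0..<l}" 0 l]] g
      atLeastLessThan_subseteq_atLeastAtMost_iff[of 0 l 0 l]
    by (simp add: set_lebesgue_integral_def)
  also have "\<dots> = integral {0..l} g"
    by (rule integral_spike_set; rule negligible_subset[of "{l}"]) auto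
  finally show ?thesis .
qed

lemma emeasure_torus_singleton: "0 < l \<Longrightarrow> emeasure (torus_measure l) {r} = 0"
  by (simp add: torus_measure_density emeasure_density nn_integral_indicator_singleton)

section \<open>Change of variables over one period\<close>

text \<open>The change of variables theorem applies off \<open>E\<close>, where \<phi> is
  differentiable and injective; the countable set \<open>E\<close> and its image are negligible. The
  image of one period is the full period starting at \<open>\<phi> 0\<close>, which periodicity of
  \<open>g\<close> moves back to the origin.\<close>

lemma integral_periodic_substitution:
  fixes \<phi> \<phi>' g :: "real \<Rightarrow> real"
  assumes l: "0 < l" and E: "countable E" and mono: "strict_mono \<phi>" and cont: "continuous_on UNIV \<phi>"
    and shift: "\<And>q. \<phi> (q + l) = \<phi> q + l"
    and deriv: "\<And>q. q \<notin> E \<Longrightarrow> (\<phi> has_real_derivative \<phi>' q) (at q)"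
    and nonneg: "\<And>q. 0 \<le> \<phi>' q"
    and g: "g \<in> borel_measurable borel" "\<And>r. \<bar>g r\<bar> \<le> C" "\<And>r. g (r + l) = g r"
  shows "integral {0..l} g = integral {0..l} (\<lambda>q. \<phi>' q * g (\<phi> q))"
proof -
  have le_iff: "\<phi> u \<le> \<phi> v \<longleftrightarrow> u \<le> v" for u v using mono by (rule strict_mono_less_eq)
  have inj: "inj \<phi>" using mono by (rule strict_mono_imp_inj_on)
  have \<phi>l: "\<phi> l = \<phi> 0 + l" using shift[of 0] by simp
  have img: "\<phi> ` {0..l} = {\<phi> 0..\<phi> l}"
  proof
    show "{\<phi> 0..\<phi> l} \<subseteq> \<phi> ` {0..l}"
    proof
      fix r assume "r \<in> {\<phi> 0..\<phi> l}"
      then obtain q where "0 \<le> q" "q \<le> l" "\<phi> q = r"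
        using IVT'[of \<phi> 0 r l] l continuous_on_subset[OF cont] by auto
      then show "r \<in> \<phi> ` {0..l}" by auto
    qed
  qed (auto simp: le_iff)
  define S where "S = {0..l} - E"
  have imgS: "\<phi> ` S = {\<phi> 0..\<phi> l} - \<phi> ` E"
    unfolding S_def img[symmetric] using inj by (simp add: image_set_diff)
  have diff: "{a..b::real} - A \<in> sets borel" if "countable A" for a b A
    by (rule sets.Diff[OF _ sets.countable[OF _ that]]) auto
  have S: "S \<in> sets borel" and imgS': "\<phi> ` S \<in> sets borel"
    unfolding imgS unfolding S_def by (simp_all only: diff E countable_image)
  have negl: "negligible A" if "countable A" for A :: "real set"
    using that unfolding negligible_iff_null_sets
    by (intro null_sets_completionI countable_imp_null_set_lborel)
  have ai: "g absolutely_integrable_on \<phi> ` S"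
    using g imgS' by (intro absolutely_integrable_bounded_borel[where a="\<phi> 0" and b="\<phi> l"]) (auto simp: imgS)
  have "integral S (\<lambda>q. \<bar>\<phi>' q\<bar> * g (\<phi> q)) = integral (\<phi> ` S) g"
    using has_absolute_integral_change_of_variables_1'[of S \<phi> \<phi>' g "integral (\<phi> ` S) g"] ai S inj deriv
    by (auto simp: S_def intro: has_field_derivative_at_within inj_on_subset)
  moreover have "integral S (\<lambda>q. \<bar>\<phi>' q\<bar> * g (\<phi> q)) = integral {0..l} (\<lambda>q. \<bar>\<phi>' q\<bar> * g (\<phi> q))"
    by (rule integral_spike_set; rule negligible_subset[OF negl[OF E]]) (auto simp: S_def)
  moreover have "integral (\<phi> ` S) g = integral {\<phi> 0..\<phi> l} g"
    by (rule integral_spike_set; rule negligible_subset[OF negl[OF countable_image[OF E, of \<phi>]]])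
       (auto simp: imgS)
  moreover have "integral {\<phi> 0..\<phi> l} g = integral {0..l} g"
  proof -
    have "(g has_integral integral {0..l} g) {0..0+l}"
      using absolutely_integrable_bounded_borel[of g C "{0..l}" 0 l] g
      by (auto intro!: integrable_integral dest: set_lebesgue_integral_eq_integral(1))
    from has_integral_periodic[OF l g(3) this, of "\<phi> 0"] show ?thesis by (auto simp: \<phi>l)
  qed
  ultimately show ?thesis using nonneg by simp
qed

section \<open>Taylor expansion with a uniform cubic remainder\<close>

lemma taylor_third_order:
  fixes f :: "real \<Rightarrow> real"
  assumes f: "C_k_on 3 f {-1<..<1}" and x: "x \<in> {-1<..<1}"
  obtains \<eta> C where "0 < \<eta>" "\<And>y. \<bar>y\<bar> \<le> \<eta> \<Longrightarrow> x + y \<in> {-1<..<1}"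
    "\<And>y. \<bar>y\<bar> \<le> \<eta> \<Longrightarrow>
      \<bar>f (x + y) - (f x + deriv f x * y + deriv (deriv f) x / 2 * y\<^sup>2)\<bar> \<le> C * \<bar>y\<bar> ^ 3"
proof -
  \<comment> \<open>Half the distance from \<open>x\<close> to the ends of the interval, so that a
    compact neighbourhood of \<open>x\<close> stays inside and the continuous third derivative is
    bounded on it.\<close>
  define \<eta> where "\<eta> = (1 - \<bar>x\<bar>) / 2"
  have \<eta>: "0 < \<eta>" using x by (auto simp: \<eta>_def)
  have sub: "{x - \<eta>..x + \<eta>} \<subseteq> {-1<..<1}" using x by (auto simp: \<eta>_def abs_if field_simps split: if_splits)
  have "continuous_on {x - \<eta>..x + \<eta>} ((deriv ^^ 3) f)"
    using f sub unfolding C_k_on_def by (blast intro: continuous_on_subset)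
  then have "bounded ((deriv ^^ 3) f ` {x - \<eta>..x + \<eta>})"
    by (intro compact_imp_bounded compact_continuous_image) auto
  then obtain C where C: "\<And>t. t \<in> {x - \<eta>..x + \<eta>} \<Longrightarrow> \<bar>(deriv ^^ 3) f t\<bar> \<le> C"
    unfolding bounded_iff real_norm_def by blast
  have C0: "0 \<le> C" using C[of x] \<eta> by auto
  have D: "DERIV ((deriv ^^ m) f) t :> (deriv ^^ Suc m) f t" if "m < 3" "t \<in> {x - \<eta>..x + \<eta>}" for m t
    using f sub that unfolding C_k_on_def by (auto simp: DERIV_deriv_iff_real_differentiable)
  have "\<bar>f (x + y) - (f x + deriv f x * y + deriv (deriv f) x / 2 * y\<^sup>2)\<bar> \<le> C * \<bar>y\<bar> ^ 3"
    if y: "\<bar>y\<bar> \<le> \<eta>" for y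
  proof (cases "y = 0")
    case False
    have "\<exists>t. (if x + y < x then x + y < t \<and> t < x else x < t \<and> t < x + y) \<and>
      f (x + y) = (\<Sum>m<3. ((deriv ^^ m) f x / fact m) * (x + y - x) ^ m) +
        ((deriv ^^ 3) f t / fact 3) * (x + y - x) ^ 3"
      using y D False by (intro Taylor[where a="x - \<eta>" and b="x + \<eta>"]) (auto simp: abs_le_iff)
    then obtain t where t: "if x + y < x then x + y < t \<and> t < x else x < t \<and> t < x + y"
      and ft: "f (x + y) = (\<Sum>m<3. ((deriv ^^ m) f x / fact m) * y ^ m) + ((deriv ^^ 3) f t / fact 3) * y ^ 3"
      by auto
    have "f (x + y) - (f x + deriv f x * y + deriv (deriv f) x / 2 * y\<^sup>2) = (deriv ^^ 3) f t / 6 * y ^ 3"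
      unfolding ft by (simp add: numeral_3_eq_3 fact_numeral numeral_2_eq_2)
    moreover have "\<bar>(deriv ^^ 3) f t / 6\<bar> \<le> C"
      using C[of t] t y C0 by (auto split: if_splits simp: abs_le_iff)
    ultimately show ?thesis by (simp only: abs_mult power_abs) (intro mult_right_mono; simp)
  qed simp
  moreover have "x + y \<in> {-1<..<1}" if "\<bar>y\<bar> \<le> \<eta>" for y
    using that by (intro subsetD[OF sub]) (auto simp: abs_le_iff)
  ultimately show thesis using that \<eta> by blast
qed

section \<open>Determinism and translation invariance of billiard trajectories\<close>

lemma flies_above_not_hit:
  assumes "flies_above F p v t'" "0 < t" "p + t *\<^sub>R v = (r, F r)"
  shows "t' \<le> t"
proof (rule ccontr)
  assume "\<not> t' \<le> t"
  then have "F (fst (p + t *\<^sub>R v)) < snd (p + t *\<^sub>R v)"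
    using assms(1,2) unfolding flies_above_def by force
  then show False unfolding assms(3) by simp
qed

lemma next_hit_unique:
  assumes "next_hit F p v r" "next_hit F p v r'"
  shows "r = r'"
proof -
  obtain t t' where t: "t > 0" "flies_above F p v t" "p + t *\<^sub>R v = (r, F r)"
    and t': "t' > 0" "flies_above F p v t'" "p + t' *\<^sub>R v = (r', F r')"
    using assms unfolding next_hit_def by blast
  have "t = t'" using flies_above_not_hit[OF t(2) t'(1,3)] flies_above_not_hit[OF t'(2) t(1,3)] by simp
  then show ?thesis using t(3) t'(3) by simp
qed

text \<open>A return from below the line forces upward motion. No hit can precede the return, since
  the flight up to it is free, and a later hit would lie at height at least \<open>c\<close>, above
  the graph.\<close>

lemma returns_to_line_not_next_hit:
  assumes below: "\<And>r. F r < c" and p: "snd p < c" and ret: "returns_to_line F c p v"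
  shows "\<not> next_hit F p v r"
proof
  assume "next_hit F p v r"
  then obtain t t' where t: "t > 0" "flies_above F p v t" "snd (p + t *\<^sub>R v) = c"
    and t': "t' > 0" "flies_above F p v t'" "p + t' *\<^sub>R v = (r, F r)"
    using ret unfolding next_hit_def returns_to_line_def by blast
  have tc: "snd p + t * snd v = c" using t(3) by simp
  then have "snd v > 0" using p t(1) by (metis add.commute less_add_same_cancel1 zero_less_mult_pos)
  then have "t * snd v \<le> t' * snd v"
    using flies_above_not_hit[OF t(2) t'(1,3)] by (intro mult_right_mono) auto
  moreover have "snd p + t' * snd v = F r" using t'(3) by (metis snd_add snd_conv snd_scaleR real_scaleR_def)
  ultimately show False using tc below[of r] by linarith
qed

lemma DERIV_translate:
  fixes F :: "real \<Rightarrow> real"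
  assumes "\<And>r. F (r + d) = F r"
  shows "(F has_field_derivative D) (at (r + d)) \<longleftrightarrow> (F has_field_derivative D) (at r)"
proof -
  have "(\<lambda>r. F (r + d)) = F" using assms by auto
  then show ?thesis using DERIV_shift[of F D r d] by simp
qed

lemma
  fixes F :: "real \<Rightarrow> real"
  assumes "\<And>r. F (r + d) = F r"
  shows differentiable_translate: "F differentiable (at (r + d)) \<longleftrightarrow> F differentiable (at r)"
    and deriv_translate: "deriv F (r + d) = deriv F r"
  by (simp_all add: real_differentiable_def deriv_def DERIV_translate[of F d, OF assms])

lemma billiard_run_translate:
  assumes "billiard_run F c n p v w" "\<And>r. F (r + d) = F r"
  shows "billiard_run F c n (p + (d, 0)) v w"
  using assms(1)
proof (induction rule: billiard_run.induct)
  case (return p v)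
  have "F (fst p + d + s) = F (fst p + s)" for s
    using assms(2)[of "fst p + s"] by (simp add: ac_simps)
  with return show ?case
    by (intro billiard_run.return) (auto simp: returns_to_line_def flies_above_def)
next
  case (collide p v r n w)
  have "F (fst p + d + s) = F (fst p + s)" for s
    using assms(2)[of "fst p + s"] by (simp add: ac_simps)
  then have "next_hit F (p + (d, 0)) v (r + d)"
    using collide(1) assms(2) by (auto simp: next_hit_def flies_above_def prod_eq_iff)
  moreover have "F differentiable (at (r + d))" "unit_normal F (r + d) = unit_normal F r"
    using collide(2) differentiable_translate[of F d, OF assms(2)] deriv_translate[of F d, OF assms(2)]
    by (simp_all add: unit_normal_def)
  ultimately show ?case
    using collide.IH by (intro billiard_run.collide[where r="r + d"]) (auto simp: assms(2))
qed

lemma return_velocity_periodic: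
  assumes "\<And>r. F (r + l) = F r"
  shows "return_velocity F c (r + l) x = return_velocity F c r x"
proof -
  have "F (r - l) = F r" for r using assms[of "r - l"] by simp
  then have "billiard_run F c n (r + l, c) v w \<longleftrightarrow> billiard_run F c n (r, c) v w" for n v w
    using billiard_run_translate[of F c n "(r, c)" v w l] billiard_run_translate[of F c n "(r + l, c)" v w "- l"] assms
    by auto
  then show ?thesis by (simp add: return_velocity_def)
qed

section \<open>Shallow cells: starting points and collision points\<close>

text \<open>\<open>B\<close> bounds the slope of the graph. By \<open>shallow\<close>, the height of
  the graph below an incoming ray changes at most half as fast as the ray descends; the factor 2 is
  the margin that keeps the derivative of \<open>launch\<close> at least 1/2 away from
  corners.\<close>

locale shallow_cell =
  fixes l c x B :: real and F :: "real \<Rightarrow> real"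
  assumes l_pos: "0 < l"
    and velocity: "x \<in> {-1<..<1}"
    and periodic: "F (r + l) = F r"
    and lipschitz: "\<bar>F u - F v\<bar> \<le> B * \<bar>u - v\<bar>"
    and shallow: "2 * B * \<bar>x\<bar> \<le> sqrt (1 - x\<^sup>2)"
    and below: "F r < c"
    and corners: "countable {r. \<not> F differentiable (at r)}"
begin

definition descent :: real where
  "descent = sqrt (1 - x\<^sup>2)"

text \<open>The starting point on the reference line of the trajectory that hits the graph over \<open>q\<close>.\<close>

definition launch :: "real \<Rightarrow> real" where
  "launch q = q - x / descent * (c - F q)"

text \<open>The value 0 at corners replaces the unspecified value of \<open>deriv\<close>, so that
  bounds and symmetry hold at every point.\<close>

definition slope :: "real \<Rightarrow> real" where
  "slope q = (if F differentiable (at q) then deriv F q else 0)"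

lemma descent_pos: "0 < descent"
  using velocity by (simp add: descent_def abs_square_less_1 abs_less_iff)

lemma B_nonneg: "0 \<le> B"
  using lipschitz[of 1 0] by (simp add: abs_ge_zero order_trans)

lemma has_derivative_slope: "F differentiable (at q) \<Longrightarrow> (F has_real_derivative slope q) (at q)"
  by (simp add: slope_def DERIV_deriv_iff_real_differentiable)

lemma slope_bound: "\<bar>slope q\<bar> \<le> B"
proof (cases "F differentiable (at q)")
  case True
  then have "((\<lambda>y. \<bar>(F y - F q) / (y - q)\<bar>) \<longlongrightarrow> \<bar>slope q\<bar>) (at q)"
    using has_derivative_slope has_field_derivative_iff by (intro tendsto_rabs) blast
  moreover have "\<forall>\<^sub>F y in at q. \<bar>(F y - F q) / (y - q)\<bar> \<le> B"
    unfolding eventually_at_filter using lipschitz[of _ q]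
    by (auto simp: abs_divide divide_le_eq)
  ultimately show ?thesis by (intro tendsto_upperbound) auto
qed (simp add: slope_def B_nonneg)

lemma continuous_F: "continuous_on S F"
proof -
  have "B-lipschitz_on UNIV F"
    using lipschitz B_nonneg by (intro lipschitz_onI) (auto simp: dist_real_def)
  then show ?thesis by (meson continuous_on_subset lipschitz_on_continuous_on subset_UNIV)
qed

text \<open>The slope is the pointwise limit of difference quotients, cut off at the countably many corners.\<close>

lemma slope_measurable: "slope \<in> borel_measurable borel"
proof (rule borel_measurable_LIMSEQ_real)
  define E where "E = {r. \<not> F differentiable (at r)}"
  let ?u = "\<lambda>n q. indicator (- E) q * ((F (q + 1 / real (Suc n)) - F q) / (1 / real (Suc n)))"
  have E: "E \<in> sets borel" using corners by (auto simp: E_def intro: sets.countable)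
  have F: "F \<in> borel_measurable borel"
    by (rule borel_measurable_continuous_onI) (rule continuous_F)
  show "?u n \<in> borel_measurable borel" for n
    using E F by (auto intro!: borel_measurable_times borel_measurable_divide borel_measurable_diff measurable_compose[OF _ F])
  show "(\<lambda>n. ?u n q) \<longlonglongrightarrow> slope q" if "q \<in> space borel" for q
  proof (cases "F differentiable (at q)")
    case True
    have "((\<lambda>e. (F (q + e) - F q) / e) \<longlongrightarrow> slope q) (at 0)"
      using has_derivative_slope[OF True] by (simp add: DERIV_def)
    moreover have "filterlim (\<lambda>n. 1 / real (Suc n)) (at 0) sequentially"
      unfolding filterlim_at using LIMSEQ_inverse_real_of_nat by (simp add: inverse_eq_divide)
    ultimately have "(\<lambda>n. (F (q + 1 / real (Suc n)) - F q) / (1 / real (Suc n))) \<longlonglongrightarrow> slope q"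
      by (rule filterlim_compose)
    then show ?thesis using True by (simp add: E_def)
  qed (simp add: E_def slope_def)
qed

lemma slope_periodic: "slope (q + l) = slope q"
  by (simp add: slope_def differentiable_translate[of F l, OF periodic] deriv_translate[of F l, OF periodic])

lemma launch_derivative:
  assumes "F differentiable (at q)"
  shows "(launch has_real_derivative 1 + x / descent * slope q) (at q)"
  unfolding launch_def using descent_pos
  by (auto intro!: derivative_eq_intros has_derivative_slope[OF assms])

lemma launch_shift: "launch (q + l) = launch q + l"
  by (simp add: launch_def periodic)

lemma continuous_launch: "continuous_on S launch"
  unfolding launch_def by (intro continuous_intros continuous_F)

text \<open>The form in which shallowness controls \<open>launch\<close>: it is used with
  \<open>d\<close> an increment of \<open>F\<close> over length \<open>e\<close>, and with
  \<open>d\<close> a slope and \<open>e = 1\<close>.\<close>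

lemma aspect_bound: "\<bar>x / descent * d\<bar> \<le> e / 2" if "\<bar>d\<bar> \<le> B * e" "0 \<le> e"
proof -
  have "\<bar>x\<bar> * \<bar>d\<bar> \<le> \<bar>x\<bar> * (B * e)" using that by (intro mult_left_mono) auto
  also have "\<dots> = (2 * B * \<bar>x\<bar>) * e / 2" by simp
  also have "\<dots> \<le> descent * e / 2"
    using shallow that unfolding descent_def by (intro divide_right_mono mult_right_mono) auto
  finally show ?thesis using descent_pos by (simp add: abs_mult field_simps)
qed

text \<open>Growth at rate at least 1/2 yields strict monotonicity and, through unboundedness,
  surjectivity.\<close>

lemma launch_diff_ge:
  assumes "u < v"
  shows "launch v - launch u \<ge> (v - u) / 2"
proof -
  have "\<bar>x / descent * (F v - F u)\<bar> \<le> (v - u) / 2"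
    using aspect_bound[of "F v - F u" "v - u"] lipschitz[of v u] assms by simp
  moreover have "launch v - launch u = v - u + x / descent * (F v - F u)"
    unfolding launch_def by (simp only: right_diff_distrib)
  ultimately show ?thesis unfolding abs_le_iff by argo
qed

lemma strict_mono_launch: "strict_mono launch"
proof (rule strict_monoI)
  fix u v :: real assume "u < v"
  then show "launch u < launch v" using launch_diff_ge[of u v] by simp
qed

lemma launch_derivative_nonneg: "0 \<le> 1 + x / descent * slope q"
proof -
  have "\<bar>x / descent * slope q\<bar> \<le> 1 / 2" using aspect_bound[of "slope q" 1] slope_bound[of q] by simp
  then show ?thesis unfolding abs_le_iff by argo
qed

lemma surj_launch: "surj launch"
proof -
  have "\<exists>q. launch q = r" for r
  proof -
    \<comment> \<open>At this distance growth at rate 1/2 overshoots \<open>r\<close> on both sides;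
      the added 1 keeps \<open>a\<close> positive.\<close>
    define a where "a = 2 * \<bar>r - launch 0\<bar> + 1"
    have "launch a \<ge> r" "launch (- a) \<le> r"
      using launch_diff_ge[of 0 a] launch_diff_ge[of "- a" 0] unfolding a_def by (argo, argo)
    then show ?thesis using IVT'[of launch "- a" r a] continuous_launch by (auto simp: a_def)
  qed
  then show ?thesis by (metis surj_def)
qed

text \<open>Followed backwards from the collision point, the ray gains height at rate
  \<open>descent\<close> while the graph rises at most half as fast, so at all earlier times the ray
  is strictly above the graph.\<close>

lemma next_hit_launch: "next_hit F (launch q, c) (incoming_velocity x) q"
proof -
  define t where "t = (c - F q) / descent"
  have t: "0 < t" "t * descent = c - F q" using below[of q] descent_pos by (auto simp: t_def)
  have q: "launch q = q - t * x" by (simp add: launch_def t_def)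
  have v: "incoming_velocity x = (x, - descent)" by (simp add: incoming_velocity_def descent_def)
  have "F (launch q + s * x) < c - s * descent" if s: "0 < s" "s < t" for s
  proof -
    have eq: "launch q + s * x - q = - ((t - s) * x)" by (simp add: q algebra_simps)
    have "F (launch q + s * x) - F q \<le> B * \<bar>launch q + s * x - q\<bar>" using lipschitz[of "launch q + s * x" q] by linarith
    also have "\<dots> = (2 * B * \<bar>x\<bar>) * (t - s) / 2" using s by (simp add: eq abs_mult)
    also have "\<dots> \<le> descent * (t - s) / 2"
      using shallow s unfolding descent_def by (intro divide_right_mono mult_right_mono) auto
    also have "\<dots> < descent * (t - s)" using s descent_pos by simp
    finally show ?thesis using t(2) by (simp add: algebra_simps)
  qed
  then show ?thesis
    using t unfolding next_hit_def flies_above_def v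
    by (intro exI[of _ t]) (auto simp: q algebra_simps)
qed

text \<open>This justifies the definite description in \<open>return_velocity\<close>: the first hit
  is determined, and since the particle can return right after it, no run has a further
  collision.\<close>

lemma reflected_velocity_unique:
  assumes hit: "next_hit F (r, c) (incoming_velocity x) q"
    and run: "billiard_run F c 1 (r, c) (incoming_velocity x) w"
    and run': "billiard_run F c n (r, c) (incoming_velocity x) w'"
  shows "w' = w"
proof -
  let ?v = "incoming_velocity x"
  let ?u = "specular_reflection (unit_normal F q) ?v"
  \<comment> \<open>The particle leaves the line downwards, so free flight never brings it back to
    height \<open>c\<close>.\<close>
  have no_return: "\<not> returns_to_line F c (r, c) ?v"
    using descent_pos by (auto simp: returns_to_line_def incoming_velocity_def descent_def)
  have "billiard_run F c 0 (q, F q) ?u w"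
    using run by (cases rule: billiard_run.cases) (use next_hit_unique[OF hit] in auto)
  then have ret: "returns_to_line F c (q, F q) ?u" and w: "w = ?u"
    by (auto elim: billiard_run.cases)
  from run' show "w' = w"
  proof cases
    case (collide q' m)
    then have "billiard_run F c m (q, F q) ?u w'" using next_hit_unique[OF hit] by auto
    then show ?thesis
      by cases (use w returns_to_line_not_next_hit[OF below _ ret] below[of q] in auto)
  qed (use no_return in auto)
qed

text \<open>The single-collision condition concerns starting points in one period only. The formula
  is proved there and carried to every \<open>q\<close> by a shift by a multiple of
  \<open>l\<close>, which commutes with \<open>launch\<close> and preserves the cell.\<close>

lemma return_velocity_launch:
  assumes q: "F differentiable (at q)" and single: "single_collision l F c x"
  shows "return_velocity F c (launch q) x
    = fst (specular_reflection (unit_normal F q) (incoming_velocity x))"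
proof -
  let ?v = "incoming_velocity x"
  have base: "return_velocity F c (launch q) x = fst (specular_reflection (unit_normal F q) ?v)"
    if q: "F differentiable (at q)" and r: "launch q \<in> {0..<l}" for q
  proof -
    \<comment> \<open>The corner alternative is excluded because the first hit is over
      \<open>q\<close>, where \<open>F\<close> is differentiable.\<close>
    obtain w where w: "billiard_run F c 1 (launch q, c) ?v w"
      using single r q next_hit_unique[OF next_hit_launch[of q]] unfolding single_collision_def by metis
    have "w = specular_reflection (unit_normal F q) ?v"
    proof -
      have "billiard_run F c 0 (q, F q) (specular_reflection (unit_normal F q) ?v) w"
        using w by (cases rule: billiard_run.cases) (use next_hit_unique[OF next_hit_launch[of q]] in auto)
      then show ?thesis by (auto elim: billiard_run.cases)
    qed
    moreover have "(THE w. \<exists>n. billiard_run F c n (launch q, c) ?v w) = w"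
      using w reflected_velocity_unique[OF next_hit_launch w] by (intro the_equality) blast+
    ultimately show ?thesis by (simp add: return_velocity_def)
  qed
  define k where "k = - \<lfloor>launch q / l\<rfloor>"
  have shift: "launch (q + of_int k * l) = launch q + of_int k * l"
    using periodic_shift_int[of "\<lambda>q. launch q - q" l q k] by (simp add: launch_shift)
  have per: "F (r + of_int k * l) = F r" for r
    by (rule periodic_shift_int) (rule periodic)
  have "launch (q + of_int k * l) \<in> {0..<l}"
    unfolding shift using floor_representative[OF l_pos, of "launch q"] by (simp add: k_def)
  then have "return_velocity F c (launch q + of_int k * l) x
      = fst (specular_reflection (unit_normal F q) ?v)"
    using base[of "q + of_int k * l"] q differentiable_translate[of F _ q, OF per] deriv_translate[of F _ q, OF per] shift
    by (simp add: unit_normal_def)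
  then show ?thesis
    using periodic_shift_int[of "\<lambda>r. return_velocity F c r x" l "launch q" k] return_velocity_periodic[of F l] periodic
    by simp
qed

end

section \<open>Expansion of the outgoing velocity in the normal component\<close>

text \<open>The horizontal component of the incoming velocity after reflection in the unit normal
  with components \<open>a\<close> and \<open>sqrt (1 - a\<^sup>2)\<close>.\<close>

definition outgoing :: "real \<Rightarrow> real \<Rightarrow> real" where
  "outgoing x a = x - 2 * (x * a - sqrt (1 - x\<^sup>2) * sqrt (1 - a\<^sup>2)) * a"

lemma legendre_operator_expand:
  assumes "C_k_on 3 f {-1<..<1}" "x \<in> {-1<..<1}"
  shows "legendre_operator f x = (1 - x\<^sup>2) * deriv (deriv f) x - 2 * x * deriv f x"
proof -
  have "deriv f differentiable (at x)"
    using assms unfolding C_k_on_def by (auto dest!: spec[of _ 1])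
  then have "(deriv f has_real_derivative deriv (deriv f) x) (at x)"
    by (simp add: DERIV_deriv_iff_real_differentiable)
  then show ?thesis unfolding legendre_operator_def
    by (intro DERIV_imp_deriv) (auto intro!: derivative_eq_intros)
qed

text \<open>The cubic remainder is factored out using \<open>sqrt (1 - a\<^sup>2) = 1 - a\<^sup>2 * e\<close> with \<open>e = 1 / (1 + sqrt (1 - a\<^sup>2))\<close>.\<close>

lemma weighted_quadratic_expansion:
  fixes a s t u w e x y f0 f1 f2 :: real
  assumes u: "u\<^sup>2 = 1 - a\<^sup>2" "u = 1 - a\<^sup>2 * e" "u * w = 1" and x: "x = t * s"
    and y: "y = a * (2 * s * u - 2 * x * a)"
  shows "(1 - t * (a * w)) * (f0 + f1 * y + f2 / 2 * y\<^sup>2)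
      - (f0 + (2 * s * f1 - t * f0) * a + (2 * s\<^sup>2 * f2 - 4 * x * f1) * a\<^sup>2)
    = a ^ 3 * (- t * f0 * (e * w) + f1 * (2 * x * t * w - 2 * s * e)
        + f2 / 2 * (4 * (x\<^sup>2 - s\<^sup>2) * a - 8 * x * s * u - t * w * (2 * s * u - 2 * x * a)\<^sup>2))"
proof -
  have w: "w = 1 + a\<^sup>2 * (e * w)" using u(2,3) by algebra
  \<comment> \<open>The identity is linear in \<open>f0\<close>, \<open>f1\<close>,
    \<open>f2\<close>, so the three coefficients are checked separately.\<close>
  have 0: "(1 - t * (a * w)) * f0 - (f0 - t * f0 * a) = a ^ 3 * (- t * f0 * (e * w))"
    using w by algebra
  have 1: "(1 - t * (a * w)) * y - (2 * s * a - 4 * x * a\<^sup>2) = a ^ 3 * (2 * x * t * w - 2 * s * e)"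
    using u(2,3) x y by algebra
  have 2: "(1 - t * (a * w)) * y\<^sup>2 - 4 * s\<^sup>2 * a\<^sup>2
    = a ^ 3 * (4 * (x\<^sup>2 - s\<^sup>2) * a - 8 * x * s * u - t * w * (2 * s * u - 2 * x * a)\<^sup>2)"
    using u(1) y by algebra
  have "(1 - t * (a * w)) * (f0 + f1 * y + f2 / 2 * y\<^sup>2)
      - (f0 + (2 * s * f1 - t * f0) * a + (2 * s\<^sup>2 * f2 - 4 * x * f1) * a\<^sup>2)
    = ((1 - t * (a * w)) * f0 - (f0 - t * f0 * a))
      + f1 * ((1 - t * (a * w)) * y - (2 * s * a - 4 * x * a\<^sup>2))
      + f2 / 2 * ((1 - t * (a * w)) * y\<^sup>2 - 4 * s\<^sup>2 * a\<^sup>2)"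
    by (simp add: field_simps)
  then show ?thesis unfolding 0 1 2 by (simp add: algebra_simps)
qed

text \<open>The weight in front of \<open>f\<close> is the derivative of \<open>launch\<close>
  expressed through \<open>a\<close>. Both the quadratic part of the displacement and the product of
  its linear part with that of the weight contribute \<open>- 2 * x * deriv f x\<close>; together
  they make the quadratic coefficient exactly twice the Legendre operator. Existence of \<alpha>
  suffices, since it will multiply the mean of an odd function.\<close>

lemma outgoing_expansion:
  fixes f :: "real \<Rightarrow> real"
  assumes f: "C_k_on 3 f {-1<..<1}" and x: "x \<in> {-1<..<1}"
  obtains \<delta> C \<alpha> where "0 < \<delta>" "\<delta> \<le> 1 / 2" "0 \<le> C"
    "continuous_on {-\<delta>..\<delta>} (\<lambda>a. f (outgoing x a))"
    "\<And>a. \<bar>a\<bar> \<le> \<delta> \<Longrightarrow>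
      \<bar>(1 - x / sqrt (1 - x\<^sup>2) * (a / sqrt (1 - a\<^sup>2))) * f (outgoing x a)
        - (f x + \<alpha> * a + 2 * legendre_operator f x * a\<^sup>2)\<bar> \<le> C * \<bar>a\<bar> ^ 3"
proof -
  obtain \<eta> C1 where \<eta>: "0 < \<eta>" and dom: "\<And>y. \<bar>y\<bar> \<le> \<eta> \<Longrightarrow> x + y \<in> {-1<..<1}"
    and taylor: "\<And>y. \<bar>y\<bar> \<le> \<eta> \<Longrightarrow>
      \<bar>f (x + y) - (f x + deriv f x * y + deriv (deriv f) x / 2 * y\<^sup>2)\<bar> \<le> C1 * \<bar>y\<bar> ^ 3"
    using taylor_third_order[OF f x] by blast
  define s t where "s = sqrt (1 - x\<^sup>2)" and "t = x / s"
  have s: "0 < s" "s \<le> 1" "s\<^sup>2 = 1 - x\<^sup>2"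
    using x by (auto simp: s_def abs_square_less_1 abs_less_iff abs_square_le_1)
  define u w e where "u a = sqrt (1 - a\<^sup>2)" and "w a = 1 / u a" and "e a = 1 / (1 + u a)" for a :: real
  define z where "z a = 2 * s * u a - 2 * x * a" for a
  define J where "J a = 1 - t * (a * w a)" for a
  define Q where "Q a = - t * f x * (e a * w a) + deriv f x * (2 * x * t * w a - 2 * s * e a)
        + deriv (deriv f) x / 2 * (4 * (x\<^sup>2 - s\<^sup>2) * a - 8 * x * s * u a - t * w a * (z a)\<^sup>2)" for a
  \<comment> \<open>The bound 1/2 keeps \<open>u a\<close> away from 0; \<eta>/4 keeps the
    displacement \<open>a * z a\<close> within the Taylor radius, because \<open>z a\<close> is at
    most 4 in modulus.\<close>
  define \<delta> where "\<delta> = min (1 / 2) (\<eta> / 4)"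
  have \<delta>: "0 < \<delta>" "\<delta> \<le> 1 / 2" "4 * \<delta> \<le> \<eta>" using \<eta> by (auto simp: \<delta>_def)
  have sq: "a\<^sup>2 \<le> 1 / 4" if "\<bar>a\<bar> \<le> \<delta>" for a
    using power_mono[of "\<bar>a\<bar>" "1 / 2" 2] that \<delta> by (simp add: power2_eq_square)
  have u: "0 < u a" "u a \<le> 1" "(u a)\<^sup>2 = 1 - a\<^sup>2" if "\<bar>a\<bar> \<le> \<delta>" for a
    using sq[OF that] by (auto simp: u_def)
  have cont_u: "continuous_on {-\<delta>..\<delta>} u" unfolding u_def by (intro continuous_intros)
  have nz: "\<forall>a\<in>{-\<delta>..\<delta>}. u a \<noteq> 0" "\<forall>a\<in>{-\<delta>..\<delta>}. 1 + u a \<noteq> 0"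
    using u(1) by (force simp: abs_le_iff)+
  have cont_we: "continuous_on {-\<delta>..\<delta>} w" "continuous_on {-\<delta>..\<delta>} e"
    unfolding w_def e_def using nz by (intro continuous_intros cont_u; simp)+
  have cont: "continuous_on {-\<delta>..\<delta>} J" "continuous_on {-\<delta>..\<delta>} Q"
    unfolding J_def Q_def z_def by (intro continuous_intros cont_u cont_we)+
  have bdd: "\<exists>C. \<forall>a\<in>{-\<delta>..\<delta>}. \<bar>g a\<bar> \<le> C" if "continuous_on {-\<delta>..\<delta>} g" for g :: "real \<Rightarrow> real"
    using compact_imp_bounded[OF compact_continuous_image[OF that]] by (auto simp: bounded_iff)
  obtain CJ CQ where CJ: "\<And>a. a \<in> {-\<delta>..\<delta>} \<Longrightarrow> \<bar>J a\<bar> \<le> CJ" and CQ: "\<And>a. a \<in> {-\<delta>..\<delta>} \<Longrightarrow> \<bar>Q a\<bar> \<le> CQ"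
    using bdd[OF cont(1)] bdd[OF cont(2)] by blast
  have CJ0: "0 \<le> CJ" and CQ0: "0 \<le> CQ" using CJ[of 0] CQ[of 0] \<delta> by auto
  have C1: "0 \<le> C1" using taylor[of \<eta>] \<eta> by (smt (verit) zero_less_power mult_neg_pos abs_of_pos)
  have out: "outgoing x a = x + a * z a" for a
    by (simp add: outgoing_def z_def u_def s_def algebra_simps)
  have z: "\<bar>z a\<bar> \<le> 4" if a: "\<bar>a\<bar> \<le> \<delta>" for a
  proof -
    have "s * u a \<le> 1 * 1" using s u[OF a] by (intro mult_mono) auto
    moreover have "0 \<le> s * u a" using s u[OF a] by auto
    moreover have "\<bar>x * a\<bar> \<le> 1 * 1" unfolding abs_mult using x a \<delta> by (intro mult_mono) auto
    ultimately show ?thesis unfolding z_def by argo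
  qed
  have az: "\<bar>a * z a\<bar> \<le> 4 * \<bar>a\<bar>" if "\<bar>a\<bar> \<le> \<delta>" for a
    using mult_left_mono[OF z[OF that], of "\<bar>a\<bar>"] by (simp add: abs_mult)
  have az': "\<bar>a * z a\<bar> \<le> \<eta>" if "\<bar>a\<bar> \<le> \<delta>" for a
    using az[OF that] that \<delta> by linarith
  define \<alpha> where "\<alpha> = 2 * s * deriv f x - t * f x"
  have cont_f: "continuous_on {-1<..<1} f"
  proof (rule continuous_at_imp_continuous_on, rule ballI)
    fix y :: real assume "y \<in> {-1<..<1}"
    then have "f differentiable (at y)" using f unfolding C_k_on_def by (metis funpow_0 zero_less_numeral)
    then show "isCont f y" by (rule differentiable_imp_continuous_within)
  qed
  \<comment> \<open>\<open>CQ\<close> bounds the cubic remainder of the weighted Taylor polynomial.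
    The other summand is the bound \<open>CJ\<close> on the weight times the Taylor error, where
    \<open>64 = 4 ^ 3\<close> comes from bounding the displacement by
    \<open>4 * \<bar>a\<bar>\<close>.\<close>
  have main: "\<bar>(1 - x / sqrt (1 - x\<^sup>2) * (a / sqrt (1 - a\<^sup>2))) * f (outgoing x a)
        - (f x + \<alpha> * a + 2 * legendre_operator f x * a\<^sup>2)\<bar> \<le> (CQ + CJ * C1 * 64) * \<bar>a\<bar> ^ 3"
    if a: "\<bar>a\<bar> \<le> \<delta>" for a
  proof -
    let ?y = "a * z a"
    let ?p = "f x + deriv f x * ?y + deriv (deriv f) x / 2 * ?y\<^sup>2"
    have a': "a \<in> {-\<delta>..\<delta>}" using a by auto
    have ue: "u a = 1 - a\<^sup>2 * e a" "u a * w a = 1"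
    proof -
      have "(1 - u a) * (1 + u a) = a\<^sup>2" using u(3)[OF a] by (simp add: algebra_simps power2_eq_square)
      then show "u a = 1 - a\<^sup>2 * e a" using u(1)[OF a] by (simp add: e_def field_simps)
      show "u a * w a = 1" using u(1)[OF a] by (simp add: w_def)
    qed
    have "J a * ?p - (f x + (2 * s * deriv f x - t * f x) * a
        + (2 * s\<^sup>2 * deriv (deriv f) x - 4 * x * deriv f x) * a\<^sup>2) = a ^ 3 * Q a"
      unfolding J_def Q_def z_def using s
      by (intro weighted_quadratic_expansion u(3)[OF a] ue) (auto simp: t_def)
    moreover have "2 * legendre_operator f x = 2 * s\<^sup>2 * deriv (deriv f) x - 4 * x * deriv f x"
      by (simp add: legendre_operator_expand[OF f x] s(3) algebra_simps)
    ultimately have p: "J a * ?p - (f x + \<alpha> * a + 2 * legendre_operator f x * a\<^sup>2) = a ^ 3 * Q a"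
      by (simp add: \<alpha>_def)
    have "\<bar>f (x + ?y) - ?p\<bar> \<le> C1 * \<bar>?y\<bar> ^ 3" by (rule taylor[OF az'[OF a]])
    also have "\<dots> \<le> C1 * (4 * \<bar>a\<bar>) ^ 3" using az[OF a] C1 by (intro mult_left_mono power_mono) auto
    finally have r: "\<bar>f (x + ?y) - ?p\<bar> \<le> C1 * 64 * \<bar>a\<bar> ^ 3" by (simp add: power_mult_distrib)
    have "\<bar>J a * (f (x + ?y) - ?p)\<bar> \<le> CJ * (C1 * 64 * \<bar>a\<bar> ^ 3)"
      unfolding abs_mult using r CJ[OF a'] CJ0 by (intro mult_mono) auto
    moreover have "\<bar>a ^ 3 * Q a\<bar> \<le> \<bar>a\<bar> ^ 3 * CQ"
      unfolding abs_mult power_abs using CQ[OF a'] by (intro mult_left_mono) auto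
    moreover have "J a * f (x + ?y) - (f x + \<alpha> * a + 2 * legendre_operator f x * a\<^sup>2)
        = a ^ 3 * Q a + J a * (f (x + ?y) - ?p)"
      using p by (simp add: right_diff_distrib)
    ultimately have "\<bar>J a * f (x + ?y) - (f x + \<alpha> * a + 2 * legendre_operator f x * a\<^sup>2)\<bar>
        \<le> \<bar>a\<bar> ^ 3 * CQ + CJ * (C1 * 64 * \<bar>a\<bar> ^ 3)" by linarith
    also have "\<dots> = (CQ + CJ * C1 * 64) * \<bar>a\<bar> ^ 3" by (simp add: algebra_simps)
    finally show ?thesis by (simp add: J_def out t_def s_def w_def u_def)
  qed
  \<comment> \<open>This gives measurability and boundedness of the integrand once \<open>a\<close>
    becomes a function of the collision point.\<close>
  have "continuous_on {-\<delta>..\<delta>} (\<lambda>a. f (outgoing x a))"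
    unfolding out using dom az' unfolding z_def
    by (intro continuous_on_compose2[OF cont_f] continuous_intros cont_u) (auto simp: abs_le_iff)
  then show thesis using that[OF \<delta>(1,2) _ _ main] CQ0 CJ0 C1 by auto
qed

section \<open>Averages over collision points\<close>

context shallow_cell
begin

text \<open>The horizontal component of the upward unit normal, extended by 0 to corners.\<close>

definition tilt :: "real \<Rightarrow> real" where
  "tilt q = - slope q / sqrt (1 + (slope q)\<^sup>2)"

lemma tilt_fst_unit_normal: "F differentiable (at q) \<Longrightarrow> fst (unit_normal F q) = tilt q"
  by (simp add: unit_normal_def tilt_def slope_def)

lemma tilt_periodic: "tilt (q + l) = tilt q"
  by (simp add: tilt_def slope_periodic)

lemma tilt_measurable: "tilt \<in> borel_measurable borel"
  unfolding tilt_def using slope_measurable by (auto intro!: borel_measurable_divide)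

lemma tilt_sq: "(tilt q)\<^sup>2 = (slope q)\<^sup>2 / (1 + (slope q)\<^sup>2)"
  by (simp add: tilt_def power_divide add_nonneg_nonneg)

lemma sqrt_tilt: "sqrt (1 - (tilt q)\<^sup>2) = 1 / sqrt (1 + (slope q)\<^sup>2)"
proof -
  have "1 + (slope q)\<^sup>2 > 0" by (simp add: add_pos_nonneg)
  then have "1 - (tilt q)\<^sup>2 = 1 / (1 + (slope q)\<^sup>2)" by (simp add: tilt_sq field_simps)
  then show ?thesis by (simp add: real_sqrt_divide)
qed

text \<open>Lets the derivative of \<open>launch\<close> be written as a function of
  \<open>tilt\<close> alone.\<close>

lemma slope_tilt: "slope q = - tilt q / sqrt (1 - (tilt q)\<^sup>2)"
proof -
  have "1 + (slope q)\<^sup>2 > 0" by (simp add: add_pos_nonneg)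
  then show ?thesis unfolding sqrt_tilt by (simp add: tilt_def)
qed

lemma abs_tilt_le_1: "\<bar>tilt q\<bar> \<le> 1"
proof -
  have "1 + (slope q)\<^sup>2 > 0" by (simp add: add_pos_nonneg)
  then have "(tilt q)\<^sup>2 \<le> 1" unfolding tilt_sq by (simp add: divide_le_eq)
  then show ?thesis by (simp only: abs_square_le_1)
qed

lemma reflected_horizontal:
  assumes "F differentiable (at q)"
  shows "fst (specular_reflection (unit_normal F q) (incoming_velocity x)) = outgoing x (tilt q)"
proof -
  have "unit_normal F q = (tilt q, sqrt (1 - (tilt q)\<^sup>2))"
    using assms by (simp add: unit_normal_def sqrt_tilt) (simp add: tilt_def slope_def)
  then show ?thesis
    by (simp add: specular_reflection_def incoming_velocity_def outgoing_def algebra_simps)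
qed

text \<open>Symmetry within one period and periodicity make \<open>F\<close> even on the whole line.
  Its derivative is then odd, and the set of corners is mirror symmetric, so the value 0 there is
  consistent.\<close>

lemma slope_reflect:
  assumes "bilaterally_symmetric l F"
  shows "slope (- q) = - slope q"
proof -
  have "F (l - r) = F r" for r
  proof -
    define k where "k = - \<lfloor>r / l\<rfloor>"
    define p where "p = r + of_int k * l"
    have p: "p \<in> {0..<l}" unfolding p_def k_def using floor_representative[OF l_pos, of r] by simp
    have "F (l - p) = F p"
    \<comment> \<open>The endpoint 0 is outside the open interval on which symmetry is assumed;
      there periodicity takes over.\<close>
    proof (cases "p = 0")
      case True
      then show ?thesis using periodic[of 0] by simp
    next
      case False
      then have "p \<in> {0<..<l}" using p by simp
      then show ?thesis using assms unfolding bilaterally_symmetric_def by metis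
    qed
    moreover have "F p = F r" unfolding p_def by (rule periodic_shift_int) (rule periodic)
    moreover have "F (l - p) = F (l - r)"
      using periodic_shift_int[of F l "l - r" "- k"] periodic by (simp add: p_def algebra_simps)
    ultimately show ?thesis by simp
  qed
  then have "F (- r) = F r" for r using periodic[of "- r"] by (simp add: add.commute)
  then have D: "(F has_field_derivative D) (at (- r)) \<longleftrightarrow> (F has_field_derivative - D) (at r)" for D r
    using DERIV_mirror[of F D r] by simp
  then have diff: "F differentiable (at (- q)) \<longleftrightarrow> F differentiable (at q)"
    unfolding real_differentiable_def by (metis minus_minus)
  show ?thesis
  proof (cases "F differentiable (at q)")
    case True
    then have "(F has_field_derivative - slope q) (at (- q))" using has_derivative_slope D by simp
    then show ?thesis using True diff by (simp add: slope_def DERIV_imp_deriv)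
  qed (simp add: slope_def diff)
qed

lemma integrable_tilt: "integrable (torus_measure l) tilt"
  using l_pos tilt_measurable abs_tilt_le_1 by (rule integrable_torus)

text \<open>By periodicity the integral over \<open>{-l..0}\<close> equals that over
  \<open>{0..l}\<close>; reflection and oddness make it equal to its own negative.\<close>

lemma integral_tilt_eq_0:
  assumes "bilaterally_symmetric l F"
  shows "(\<integral>q. tilt q \<partial>torus_measure l) = 0"
proof -
  have "tilt absolutely_integrable_on {0..l}"
    using tilt_measurable abs_tilt_le_1 by (rule absolutely_integrable_bounded_borel) auto
  then have I: "(tilt has_integral integral {0..l} tilt) {0..0+l}"
    by (auto intro!: integrable_integral dest: set_lebesgue_integral_eq_integral(1))
  have "(tilt has_integral integral {0..l} tilt) {-l..-l+l}"
    by (rule has_integral_periodic[OF l_pos tilt_periodic I])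
  then have "((\<lambda>q. tilt (- q)) has_integral integral {0..l} tilt) {0..l}"
    using l_pos by (subst (asm) has_integral_reflect_real[symmetric]) simp_all
  moreover have "tilt (- q) = - tilt q" for q
    by (simp add: tilt_def slope_reflect[OF assms])
  ultimately have "((\<lambda>q. - tilt q) has_integral integral {0..l} tilt) {0..l}" by simp
  moreover have "((\<lambda>q. - tilt q) has_integral - integral {0..l} tilt) {0..l}"
    using I by (intro has_integral_neg) simp
  ultimately have "integral {0..l} tilt = - integral {0..l} tilt" by (rule has_integral_unique)
  then show ?thesis
    using integral_torus[OF l_pos tilt_measurable abs_tilt_le_1] by simp
qed

lemma integral_torus_off_corners:
  fixes g h :: "real \<Rightarrow> real"
  assumes "countable X" "\<And>r. r \<notin> X \<Longrightarrow> g r = h r"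
  shows "(\<integral>r. g r \<partial>torus_measure l) = (\<integral>r. h r \<partial>torus_measure l)"
  using assms l_pos emeasure_torus_singleton by (intro integral_discrete_difference[where X=X]) auto

lemma flatness_tilt: "flatness l F = (\<integral>q. (tilt q)\<^sup>2 \<partial>torus_measure l)"
  unfolding flatness_def
  by (rule integral_torus_off_corners[OF corners]) (simp add: tilt_sq slope_def)

text \<open>The return velocity is explicit only as a function of the collision point. The average
  over starting points is therefore written through the inverse \<psi> of \<open>launch\<close>, and
  \<open>launch\<close> is then substituted.\<close>

lemma transition_operator_tilt:
  fixes g :: "real \<Rightarrow> real"
  assumes single: "single_collision l F c x"
    and \<delta>: "\<And>q. \<bar>tilt q\<bar> \<le> \<delta>" and g: "continuous_on {-\<delta>..\<delta>} (\<lambda>a. f (outgoing x a))"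
  defines "w \<equiv> \<lambda>q. (1 - x / sqrt (1 - x\<^sup>2) * (tilt q / sqrt (1 - (tilt q)\<^sup>2))) * f (outgoing x (tilt q))"
  shows "transition_operator l F c f x = (\<integral>q. w q \<partial>torus_measure l)"
    and "integrable (torus_measure l) w"
proof -
  define G where "G q = f (outgoing x (tilt q))" for q
  have tilt_in: "tilt q \<in> {-\<delta>..\<delta>}" for q using \<delta>[of q] by auto
  have meas: "G \<in> borel_measurable borel"
  proof -
    \<comment> \<open>Continuity is available only on \<open>{-\<delta>..\<delta>}\<close>, which
      contains all values of \<open>tilt\<close>; the cutoff outside leaves \<open>G\<close>
      unchanged.\<close>
    have "(\<lambda>a. indicator {-\<delta>..\<delta>} a *\<^sub>R f (outgoing x a)) \<in> borel_measurable borel"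
      using g by (intro borel_measurable_continuous_on_indicator) auto
    from measurable_compose[OF tilt_measurable this] show ?thesis
      unfolding G_def using tilt_in by (simp add: indicator_def)
  qed
  have "bounded ((\<lambda>a. f (outgoing x a)) ` {-\<delta>..\<delta>})"
    by (intro compact_imp_bounded compact_continuous_image g) auto
  then obtain CG where "\<And>a. a \<in> {-\<delta>..\<delta>} \<Longrightarrow> \<bar>f (outgoing x a)\<bar> \<le> CG"
    unfolding bounded_iff real_norm_def by blast
  then have CG: "\<bar>G q\<bar> \<le> CG" for q using tilt_in by (simp add: G_def)
  have G_periodic: "G (q + l) = G q" for q by (simp add: G_def tilt_periodic)
  define \<psi> where "\<psi> = inv launch"
  have inj: "inj launch" by (rule strict_mono_imp_inj_on[OF strict_mono_launch])
  have \<psi>: "launch (\<psi> r) = r" "\<psi> (launch q) = q" for r q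
    using surj_launch inj by (simp_all add: \<psi>_def surj_f_inv_f)
  have "mono \<psi>"
    using strict_mono_less_eq[OF strict_mono_launch] \<psi>(1) by (metis monoI)
  then have \<psi>_meas: "\<psi> \<in> borel_measurable borel" by (rule borel_measurable_mono)
  have \<psi>_shift: "\<psi> (r + l) = \<psi> r + l" for r using \<psi> launch_shift by metis
  define jac where "jac q = 1 + x / descent * slope q" for q
  have w: "w q = jac q * G q" for q
    unfolding w_def jac_def G_def descent_def by (subst slope_tilt) simp
  have "jac \<in> borel_measurable borel"
    unfolding jac_def by (intro borel_measurable_add borel_measurable_times borel_measurable_const slope_measurable)
  then have "(\<lambda>q. jac q * G q) \<in> borel_measurable borel" using meas by (rule borel_measurable_times)
  then have w_meas: "w \<in> borel_measurable borel" by (simp add: w cong: measurable_cong)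
  have jac_le: "\<bar>jac q\<bar> \<le> 2" for q
  proof -
    have "\<bar>x / descent * slope q\<bar> \<le> 1 / 2" using aspect_bound[of "slope q" 1] slope_bound[of q] by simp
    then show ?thesis unfolding jac_def by argo
  qed
  have w_bound: "\<bar>w q\<bar> \<le> 2 * CG" for q
    unfolding w abs_mult using jac_le CG by (intro mult_mono) auto
  show "integrable (torus_measure l) w"
    using l_pos w_meas w_bound by (rule integrable_torus)
  have "transition_operator l F c f x = (\<integral>r. G (\<psi> r) \<partial>torus_measure l)"
    unfolding transition_operator_def
  proof (rule integral_torus_off_corners)
    \<comment> \<open>Starting points that lead into a corner, where the return velocity is
      unspecified, form a countable and hence null set.\<close>
    show "countable (launch ` {r. \<not> F differentiable (at r)})" using corners by (rule countable_image)
    fix r assume "r \<notin> launch ` {r. \<not> F differentiable (at r)}"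
    then have "F differentiable (at (\<psi> r))" using \<psi>(1)[of r] by (metis imageI mem_Collect_eq)
    from return_velocity_launch[OF this single] reflected_horizontal[OF this]
    show "f (return_velocity F c r x) = G (\<psi> r)" by (simp add: \<psi> G_def)
  qed
  also have "\<dots> = integral {0..l} (\<lambda>r. G (\<psi> r)) / l"
    using measurable_compose[OF \<psi>_meas meas] CG by (intro integral_torus[OF l_pos]) auto
  also have "integral {0..l} (\<lambda>r. G (\<psi> r)) = integral {0..l} (\<lambda>q. jac q * G (\<psi> (launch q)))"
  proof (rule integral_periodic_substitution[OF l_pos corners strict_mono_launch continuous_launch])
    show "(\<lambda>r. G (\<psi> r)) \<in> borel_measurable borel" by (rule measurable_compose[OF \<psi>_meas meas])
    show "(launch has_real_derivative jac q) (at q)" if "q \<notin> {r. \<not> F differentiable (at r)}" for q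
      unfolding jac_def using that by (intro launch_derivative) simp
    show "\<bar>G (\<psi> r)\<bar> \<le> CG" for r by (rule CG)
    show "0 \<le> jac q" for q unfolding jac_def by (rule launch_derivative_nonneg)
  qed (simp_all only: launch_shift \<psi>_shift G_periodic)
  also have "\<dots> / l = (\<integral>q. w q \<partial>torus_measure l)"
    unfolding \<psi> w[symmetric] using integral_torus[OF l_pos w_meas w_bound] by simp
  finally show "transition_operator l F c f x = (\<integral>q. w q \<partial>torus_measure l)" .
qed

text \<open>After integration the constant term cancels against \<open>f x\<close>, the linear term
  vanishes by symmetry, and the quadratic term is \<beta> times the flatness. Total mass 1 preserves
  the bound on the remainder.\<close>

lemma billiard_generator_estimate:
  assumes single: "single_collision l F c x" and sym: "bilaterally_symmetric l F"
    and \<epsilon>: "\<And>q. \<bar>tilt q\<bar> \<le> \<epsilon>" "\<epsilon> \<le> \<delta>" and C: "0 \<le> C"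
    and g: "continuous_on {-\<delta>..\<delta>} (\<lambda>a. f (outgoing x a))"
    and expansion: "\<And>a. \<bar>a\<bar> \<le> \<delta> \<Longrightarrow>
      \<bar>(1 - x / sqrt (1 - x\<^sup>2) * (a / sqrt (1 - a\<^sup>2))) * f (outgoing x a)
        - (f x + \<alpha> * a + \<beta> * a\<^sup>2)\<bar> \<le> C * \<bar>a\<bar> ^ 3"
  shows "\<bar>billiard_generator l F c f x - \<beta> * flatness l F\<bar> \<le> C * \<epsilon> ^ 3"
proof -
  let ?M = "torus_measure l"
  define w where "w q = (1 - x / sqrt (1 - x\<^sup>2) * (tilt q / sqrt (1 - (tilt q)\<^sup>2))) * f (outgoing x (tilt q))" for q
  have \<delta>: "\<bar>tilt q\<bar> \<le> \<delta>" for q using \<epsilon>(1)[of q] \<epsilon>(2) by simp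
  have w_int: "integrable ?M w" and trans: "transition_operator l F c f x = (\<integral>q. w q \<partial>?M)"
    unfolding w_def using transition_operator_tilt[OF single \<delta> g] by auto
  have sq_int: "integrable ?M (\<lambda>q. (tilt q)\<^sup>2)"
    using tilt_measurable abs_tilt_le_1
    by (intro integrable_torus[OF l_pos, where C=1]) (auto simp: abs_square_le_1)
  interpret finite_measure ?M by (rule finite_measure_torus[OF l_pos])
  let ?p = "\<lambda>q. f x + \<alpha> * tilt q + \<beta> * (tilt q)\<^sup>2"
  have p_int: "integrable ?M ?p" using integrable_tilt sq_int by simp
  have "(\<integral>q. ?p q \<partial>?M) = f x + \<alpha> * (\<integral>q. tilt q \<partial>?M) + \<beta> * (\<integral>q. (tilt q)\<^sup>2 \<partial>?M)"
    using integrable_tilt sq_int by (simp add: measure_torus_UNIV[OF l_pos])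
  then have p: "(\<integral>q. ?p q \<partial>?M) = f x + \<beta> * flatness l F"
    by (simp add: integral_tilt_eq_0[OF sym] flatness_tilt)
  have gen: "billiard_generator l F c f x - \<beta> * flatness l F = (\<integral>q. w q - ?p q \<partial>?M)"
    using w_int p_int p by (simp add: billiard_generator_def trans)
  have "\<bar>billiard_generator l F c f x - \<beta> * flatness l F\<bar> \<le> (\<integral>q. \<bar>w q - ?p q\<bar> \<partial>?M)"
    unfolding gen by (rule integral_abs_bound)
  also have "\<dots> \<le> (\<integral>q. C * \<epsilon> ^ 3 \<partial>?M)"
  proof (rule integral_mono)
    show "integrable ?M (\<lambda>q. \<bar>w q - ?p q\<bar>)"
      by (rule integrable_abs, rule Bochner_Integration.integrable_diff[OF w_int p_int])
    show "integrable ?M (\<lambda>q. C * \<epsilon> ^ 3)" by simp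
    show "\<bar>w q - ?p q\<bar> \<le> C * \<epsilon> ^ 3" for q
    proof -
      have "\<bar>w q - ?p q\<bar> \<le> C * \<bar>tilt q\<bar> ^ 3" unfolding w_def by (rule expansion[OF \<delta>])
      also have "\<dots> \<le> C * \<epsilon> ^ 3" by (rule mult_left_mono[OF power_mono[OF \<epsilon>(1) abs_ge_zero] C])
      finally show ?thesis .
    qed
  qed
  also have "\<dots> = C * \<epsilon> ^ 3" by (simp add: measure_torus_UNIV[OF l_pos])
  finally show ?thesis .
qed

end

section \<open>Piecewise smooth graphs with small normal component are shallow\<close>

lemma finite_corners:
  assumes l: "0 < l" and F: "piecewise_smooth_torus l F"
  shows "finite ({r. \<not> F differentiable (at r)} \<inter> {a..b})"
proof -
  obtain S where S: "finite S" "smooth_on_open F ({0<..<l} - S)" and per: "\<And>r. F (r + l) = F r"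
    using F unfolding piecewise_smooth_torus_def by blast
  have diff: "F differentiable (at r)" if "r \<in> {0<..<l} - S" for r
    using S(2) that unfolding smooth_on_open_def by (metis funpow_0)
  \<comment> \<open>Reduced modulo \<open>l\<close>, a corner lands in \<open>S\<close> or at 0; the
    point 0 is added because smoothness is assumed only inside the open period.\<close>
  have "{r. \<not> F differentiable (at r)} \<inter> {a..b}
      \<subseteq> (\<lambda>(p, k). p + of_int k * l) ` (insert 0 S \<times> {\<lfloor>a / l\<rfloor>..\<lfloor>b / l\<rfloor>})"
  proof
    fix r assume r: "r \<in> {r. \<not> F differentiable (at r)} \<inter> {a..b}"
    define k where "k = \<lfloor>r / l\<rfloor>"
    define p where "p = r - of_int k * l"
    have p: "p \<in> {0..<l}" unfolding p_def k_def by (rule floor_representative[OF l])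
    have "F (q + of_int k * l) = F q" for q by (rule periodic_shift_int) (rule per)
    then have "\<not> F differentiable (at p)" using r differentiable_translate[of F "of_int k * l" p] by (simp add: p_def)
    then have "p \<in> insert 0 S" using p diff[of p] by force
    moreover have "k \<in> {\<lfloor>a / l\<rfloor>..\<lfloor>b / l\<rfloor>}"
      using r l by (auto simp: k_def intro!: floor_mono divide_right_mono)
    moreover have "r = p + of_int k * l" by (simp add: p_def)
    ultimately show "r \<in> (\<lambda>(p, k). p + of_int k * l) ` (insert 0 S \<times> {\<lfloor>a / l\<rfloor>..\<lfloor>b / l\<rfloor>})" by auto
  qed
  then show ?thesis using S(1) by (auto intro: finite_subset)
qed

lemma countable_corners:
  assumes "0 < l" "piecewise_smooth_torus l F"
  shows "countable {r. \<not> F differentiable (at r)}"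
proof -
  have "{r. \<not> F differentiable (at r)} = (\<Union>n. {r. \<not> F differentiable (at r)} \<inter> {- real n..real n})"
  proof -
    have "\<exists>n. r \<in> {- real n..real n}" for r :: real
      using real_arch_simple[of "\<bar>r\<bar>"] by (simp add: abs_le_iff) (metis minus_le_iff)
    then show ?thesis by blast
  qed
  moreover have "countable (\<Union>n. {r. \<not> F differentiable (at r)} \<inter> {- real n..real n})"
    by (intro countable_UN[OF countableI_type] countable_finite[OF finite_corners[OF assms]])
  ultimately show ?thesis by simp
qed

text \<open>For continuous \<open>F\<close>, finitely many corners in a bounded interval do not
  disturb the fundamental theorem of calculus, so a bound on the derivative elsewhere controls all
  increments.\<close>

lemma lipschitz_of_derivative_bound:
  assumes l: "0 < l" and F: "piecewise_smooth_torus l F" and B: "0 \<le> B"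
    and bound: "\<And>r. F differentiable (at r) \<Longrightarrow> \<bar>deriv F r\<bar> \<le> B"
  shows "\<bar>F u - F v\<bar> \<le> B * \<bar>u - v\<bar>"
proof -
  have *: "\<bar>F v - F u\<bar> \<le> B * (v - u)" if "u \<le> v" for u v
  proof -
    let ?S = "{r. \<not> F differentiable (at r)} \<inter> {u..v}"
    have S: "finite ?S" by (rule finite_corners[OF l F])
    have "(deriv F has_integral (F v - F u)) {u..v}"
    proof (rule fundamental_theorem_of_calculus_interior_strong[OF S that])
      show "continuous_on {u..v} F"
        using F unfolding piecewise_smooth_torus_def by (blast intro: continuous_on_subset)
      show "(F has_vector_derivative deriv F r) (at r)" if "r \<in> {u<..<v} - ?S" for r
        using that unfolding has_real_derivative_iff_has_vector_derivative[symmetric] by (auto simp: DERIV_deriv_iff_real_differentiable)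
    qed
    then have "norm (F v - F u) \<le> B * measure lborel (cbox u v)"
      using B S bound by (intro has_integral_bound_spike_finite[where S="?S"]) auto
    then show ?thesis using that by simp
  qed
  show ?thesis using *[of u v] *[of v u] by (cases "u \<le> v") (auto simp: abs_minus_commute)
qed

text \<open>A real \<open>Sup\<close> dominates the set only if the set is bounded above; here the
  range is the image of one compact period.\<close>

lemma below_of_Sup:
  assumes l: "0 < l" and F: "piecewise_smooth_torus l F" and c: "Sup (range F) < c"
  shows "F r < c"
proof -
  have per: "F (q + l) = F q" for q using F by (simp add: piecewise_smooth_torus_def)
  have "range F \<subseteq> F ` {0..l}"
  proof clarify
    fix q
    have "F (q - of_int \<lfloor>q / l\<rfloor> * l) = F q" using periodic_shift_int[of F l q "- \<lfloor>q / l\<rfloor>"] per by simp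
    then show "F q \<in> F ` {0..l}" using floor_representative[OF l, of q]
      by (metis atLeastLessThan_iff atLeastAtMost_iff image_eqI less_imp_le)
  qed
  moreover have "compact (F ` {0..l})"
    using F unfolding piecewise_smooth_torus_def
    by (blast intro: compact_continuous_image continuous_on_subset compact_Icc)
  ultimately have "bdd_above (range F)"
    by (meson bdd_above_mono bounded_imp_bdd_above compact_imp_bounded)
  then have "F r \<le> Sup (range F)" by (intro cSup_upper) auto
  then show ?thesis using c by simp
qed

text \<open>With slope \<open>d\<close>, the bound reads
  \<open>d\<^sup>2 \<le> e\<^sup>2 * (1 + d\<^sup>2)\<close>. Since \<open>e \<le> 1 / 2\<close>,
  the term \<open>e\<^sup>2 * d\<^sup>2\<close> is at most a quarter of \<open>d\<^sup>2\<close> and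
  is absorbed on the left.\<close>

lemma slope_le_of_normal:
  assumes "\<bar>fst (unit_normal F r)\<bar> \<le> e" "e \<le> 1 / 2"
  shows "\<bar>deriv F r\<bar> \<le> 2 * e"
proof -
  let ?d = "deriv F r"
  have pos: "1 + ?d\<^sup>2 > 0" by (simp add: add_pos_nonneg)
  have e0: "0 \<le> e" using assms(1) by linarith
  have "(fst (unit_normal F r))\<^sup>2 = ?d\<^sup>2 / (1 + ?d\<^sup>2)"
    using pos by (simp add: unit_normal_def power_divide)
  moreover have "(fst (unit_normal F r))\<^sup>2 \<le> e\<^sup>2"
    using power_mono[OF assms(1), of 2] by simp
  ultimately have "?d\<^sup>2 \<le> e\<^sup>2 * (1 + ?d\<^sup>2)" using pos_divide_le_eq[OF pos] by metis
  then have "?d\<^sup>2 \<le> e\<^sup>2 + e\<^sup>2 * ?d\<^sup>2" by (simp add: distrib_left)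
  moreover have "e\<^sup>2 * ?d\<^sup>2 \<le> 1 / 4 * ?d\<^sup>2"
    using power_mono[OF assms(2) e0, of 2] by (intro mult_right_mono) (auto simp: power2_eq_square)
  moreover have "0 \<le> ?d\<^sup>2" "(2 * e)\<^sup>2 = 4 * e\<^sup>2" by (simp_all add: power_mult_distrib)
  ultimately have "?d\<^sup>2 \<le> (2 * e)\<^sup>2" by linarith
  then show ?thesis using e0 by (metis abs_le_square_iff abs_of_nonneg mult_nonneg_nonneg zero_le_numeral)
qed

section \<open>Uniform estimate for small flatness and passage to the limit\<close>

theorem theorem3:
  fixes l h0 K x :: real
    and F :: "real \<Rightarrow> real \<Rightarrow> real"
    and c :: "real \<Rightarrow> real"
    and f :: "real \<Rightarrow> real"
  assumes l_pos: "0 < l" and h0_pos: "0 < h0"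
    and smooth: "\<And>h. h \<in> {0<..<h0} \<Longrightarrow> piecewise_smooth_torus l (F h)"
    and symmetric: "\<And>h. h \<in> {0<..<h0} \<Longrightarrow> bilaterally_symmetric l (F h)"
    and flatness: "\<And>h. h \<in> {0<..<h0} \<Longrightarrow> flatness l (F h) = h"
    and reference_line: "\<And>h. h \<in> {0<..<h0} \<Longrightarrow> Sup (range (F h)) < c h"
    and normal_bound: "\<And>h r. h \<in> {0<..<h0} \<Longrightarrow> F h differentiable (at r) \<Longrightarrow>
           \<bar>fst (unit_normal (F h) r)\<bar> \<le> K * sqrt h"
    and f_C3: "C_k_on 3 f {-1<..<1}"
    and x_velocity: "x \<in> {-1<..<1}"
  shows "(\<lambda>h. billiard_generator l (F h) (c h) f x - 2 * h * legendre_operator f x)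
           \<in> O[at 0 within {h \<in> {0<..<h0}. single_collision l (F h) (c h) x}](\<lambda>h. h powr (3/2))"
proof -
  obtain \<delta> C \<alpha> where \<delta>: "0 < \<delta>" "\<delta> \<le> 1 / 2" and C: "0 \<le> C"
    and cont: "continuous_on {-\<delta>..\<delta>} (\<lambda>a. f (outgoing x a))"
    and expansion: "\<And>a. \<bar>a\<bar> \<le> \<delta> \<Longrightarrow>
      \<bar>(1 - x / sqrt (1 - x\<^sup>2) * (a / sqrt (1 - a\<^sup>2))) * f (outgoing x a)
        - (f x + \<alpha> * a + 2 * legendre_operator f x * a\<^sup>2)\<bar> \<le> C * \<bar>a\<bar> ^ 3"
    using outgoing_expansion[OF f_C3 x_velocity] by blast
  define s where "s = sqrt (1 - x\<^sup>2)"
  have s: "0 < s" using x_velocity by (auto simp: s_def abs_square_less_1 abs_less_iff)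
  \<comment> \<open>A strictly positive upper bound for \<open>K\<close>, so that division by it is
    possible.\<close>
  define k where "k = \<bar>K\<bar> + 1"
  \<comment> \<open>Threshold for \<open>\<epsilon> = k * sqrt h\<close>: \<delta> is the range of
    the expansion, and \<open>s / 4\<close> gives shallowness with Lipschitz constant
    \<open>2 * \<epsilon>\<close>, because \<open>2 * (2 * \<epsilon>) * \<bar>x\<bar> \<le> 4 *
    \<epsilon> \<le> s\<close>.\<close>
  define \<kappa> where "\<kappa> = min \<delta> (s / 4)"
  have k: "0 < k" and \<kappa>: "0 < \<kappa>" using \<delta> s by (auto simp: k_def \<kappa>_def)
  have estimate: "\<bar>billiard_generator l (F h) (c h) f x - 2 * h * legendre_operator f x\<bar>
      \<le> C * k ^ 3 * h powr (3/2)"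
    if h: "h \<in> {0<..<h0}" and single: "single_collision l (F h) (c h) x" and small: "h < (\<kappa> / k)\<^sup>2" for h
  proof -
    define \<epsilon> where "\<epsilon> = k * sqrt h"
    have h0: "0 < h" using h by simp
    have "sqrt h < \<kappa> / k" using small \<kappa> k by (intro real_less_lsqrt) auto
    then have \<epsilon>: "0 \<le> \<epsilon>" "\<epsilon> \<le> \<delta>" "4 * \<epsilon> \<le> s"
      using k h0 by (auto simp: \<epsilon>_def \<kappa>_def field_simps)
    have normal: "\<bar>fst (unit_normal (F h) r)\<bar> \<le> \<epsilon>" if "F h differentiable (at r)" for r
    proof -
      have "K * sqrt h \<le> k * sqrt h" using h0 by (intro mult_right_mono) (auto simp: k_def)
      then show ?thesis using normal_bound[OF h that] by (simp add: \<epsilon>_def)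
    qed
    interpret shallow_cell l "c h" x "2 * \<epsilon>" "F h"
    proof
      show "0 < l" "x \<in> {-1<..<1}" by fact+
      show "F h (r + l) = F h r" for r using smooth[OF h] by (simp add: piecewise_smooth_torus_def)
      have "\<bar>deriv (F h) r\<bar> \<le> 2 * \<epsilon>" if "F h differentiable (at r)" for r
        using slope_le_of_normal[OF normal[OF that]] \<epsilon> \<delta> by simp
      then show "\<bar>F h u - F h v\<bar> \<le> 2 * \<epsilon> * \<bar>u - v\<bar>" for u v
        using lipschitz_of_derivative_bound[OF l_pos smooth[OF h]] \<epsilon>(1) by simp
      have "\<bar>x\<bar> \<le> 1" using x_velocity by (simp add: abs_le_iff)
      then have "2 * (2 * \<epsilon>) * \<bar>x\<bar> \<le> 2 * (2 * \<epsilon>) * 1" using \<epsilon>(1) by (intro mult_left_mono) simp_all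
      then show "2 * (2 * \<epsilon>) * \<bar>x\<bar> \<le> sqrt (1 - x\<^sup>2)" using \<epsilon>(3) unfolding s_def by linarith
      show "F h r < c h" for r using below_of_Sup[OF l_pos smooth[OF h] reference_line[OF h]] .
      show "countable {r. \<not> F h differentiable (at r)}" by (rule countable_corners[OF l_pos smooth[OF h]])
    qed
    have tilt: "\<bar>tilt q\<bar> \<le> \<epsilon>" for q
    proof (cases "F h differentiable (at q)")
      case True
      then show ?thesis using normal tilt_fst_unit_normal by metis
    qed (use \<epsilon> in \<open>simp add: tilt_def slope_def\<close>)
    have "\<bar>billiard_generator l (F h) (c h) f x - 2 * legendre_operator f x * flatness l (F h)\<bar> \<le> C * \<epsilon> ^ 3"
      by (rule billiard_generator_estimate[OF single symmetric[OF h] tilt \<epsilon>(2) C cont expansion])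
    moreover have "sqrt h ^ 3 = h powr (3/2)"
      using h0 by (simp add: powr_half_sqrt[symmetric] powr_powr flip: powr_realpow)
    ultimately show ?thesis
      by (simp add: flatness[OF h] \<epsilon>_def power_mult_distrib mult_ac)
  qed
  show ?thesis
  proof (rule bigoI)
    \<comment> \<open>This radius is the condition \<open>k * sqrt h < \<kappa>\<close> squared; the
      filter itself supplies the single-collision condition at each \<open>h\<close>.\<close>
    have "0 < (\<kappa> / k)\<^sup>2" using \<kappa> k by simp
    then show "\<forall>\<^sub>F h in at 0 within {h \<in> {0<..<h0}. single_collision l (F h) (c h) x}.
        norm (billiard_generator l (F h) (c h) f x - 2 * h * legendre_operator f x)
        \<le> C * k ^ 3 * norm (h powr (3/2))"
      unfolding eventually_at using estimate by (intro exI[of _ "(\<kappa> / k)\<^sup>2"]) auto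
  qed
qed

end
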